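(* Let $N\ge 1$, let $\mathcal{X}\in\mathbb{R}^{I_1\times\cdots\times I_N}$ be a tensor with set of observable index tuples $\Omega\subseteq [I_1]\times\cdots\times[I_N]$, let $\mathcal{G}\in\mathbb{R}^{J_1\times\cdots\times J_N}$ be a core tensor, let $\mathbf{A}^{(k)}\in\mathbb{R}^{I_k\times J_k}$ ($k=1,\dots,N$) be factor matrices, and let $\lambda>0$. Fix a mode $n\in\{1,\dots,N\}$ and a row index $i_n\in\{1,\dots,I_n\}$. Keep $\mathcal{G}$, all factor matrices $\mathbf{A}^{(k)}$ with $k\ne n$, and all rows of $\mathbf{A}^{(n)}$ other than the $i_n$th fixed, and regard the loss $L(\mathcal{G},\mathbf{A}^{(1)},\dots,\mathbf{A}^{(N)})$ as a function of the $i_n$th row $[a^{(n)}_{i_n1},\dots,a^{(n)}_{i_nJ_n}]\in\mathbb{R}^{1\times J_n}$ of $\mathbf{A}^{(n)}$. Then this function is minimized by the row-wise update rule, that is, $$\operatorname*{arg\,min}_{[a^{(n)}_{i_n1},\dots,a^{(n)}_{i_nJ_n}]} L(\mathcal{G},\mathbf{A}^{(1)},\dots,\mathbf{A}^{(N)}) \;=\; \mathbf{c}^{(n)}_{i_n:}\,\bigl[\mathbf{B}^{(n)}_{i_n}+\lambda\mathbf{I}_{J_n}\bigr]^{-1}.$$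
   Context: Notation: $[m]=\{1,\dots,m\}$; $a^{(k)}_{ij}$ is the $(i,j)$ entry of $\mathbf{A}^{(k)}$; $\mathbf{I}_{J_n}$ is the $J_n\times J_n$ identity matrix; $\|\cdot\|$ is the Frobenius norm. Loss function: $$L(\mathcal{G},\mathbf{A}^{(1)},\dots,\mathbf{A}^{(N)})=\sum_{(i_1,\dots,i_N)\in\Omega}\Bigl(\mathcal{X}_{(i_1,\dots,i_N)}-\sum_{(j_1,\dots,j_N)\in[J_1]\times\cdots\times[J_N]}\mathcal{G}_{(j_1,\dots,j_N)}\prod_{k=1}^N a^{(k)}_{i_kj_k}\Bigr)^2+\lambda\sum_{k=1}^N\|\mathbf{A}^{(k)}\|^2 .$$ $\Omega^{(n)}_{i_n}$ is the subset of $\Omega$ of those tuples whose $n$th coordinate equals $i_n$. For $\alpha=(i_1,\dots,i_N)\in\Omega$, $\delta^{(n)}_\alpha\in\mathbb{R}^{1\times J_n}$ is the row vector whose $j$th entry is $$\delta^{(n)}_\alpha(j)=\sum_{(j_1,\dots,j_N):\,j_n=j}\mathcal{G}_{(j_1,\dots,j_N)}\prod_{k\ne n}a^{(k)}_{i_kj_k}.$$ $\mathbf{B}^{(n)}_{i_n}$ is the $J_n\times J_n$ matrix whose $(j,j')$ entry is $\sum_{\alpha\in\Omega^{(n)}_{i_n}}\delta^{(n)}_\alpha(j)\,\delta^{(n)}_\alpha(j')$. $\mathbf{c}^{(n)}_{i_n:}\in\mathbb{R}^{1\times J_n}$ is the row vector whose $j$th entry is $\sum_{\alpha\in\Omega^{(n)}_{i_n}}\mathcal{X}_\alpha\,\delta^{(n)}_\alpha(j)$.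 *)

theory Defs
  imports
    Complex_Main
    "HOL-Library.FuncSet"
    "Jordan_Normal_Form.Matrix"
    "Jordan_Normal_Form.Gauss_Jordan_Elimination"
begin

text \<open>
  Modes and coordinates are counted from 0, as matrix entries are in the matrix library:
  the set of modes is \<open>{..<N}\<close>, the coordinates in mode \<open>k\<close> of a tensor with dimensions
  \<open>I\<close> are \<open>{..<I k}\<close>.  An index tuple is an extensional function on the modes, so that two
  tuples are equal iff their coordinates are.  A tensor is a function on index tuples; only its
  values on \<open>index_tuples N I\<close> are ever used.  Row vectors of length \<open>m\<close> are
  \<open>1 \<times> m\<close> matrices.
\<close>

type_synonym tensor = "(nat \<Rightarrow> nat) \<Rightarrow> real"

definition index_tuples :: "nat \<Rightarrow> (nat \<Rightarrow> nat) \<Rightarrow> (nat \<Rightarrow> nat) set" where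
  "index_tuples N I = (\<Pi>\<^sub>E k\<in>{..<N}. {..<I k})"

definition frobenius_norm :: "real mat \<Rightarrow> real" where
  "frobenius_norm A = sqrt (\<Sum>i<dim_row A. \<Sum>j<dim_col A. (A $$ (i, j))\<^sup>2)"

definition loss ::
  "nat \<Rightarrow> (nat \<Rightarrow> nat) \<Rightarrow> (nat \<Rightarrow> nat) set \<Rightarrow> real \<Rightarrow> tensor \<Rightarrow> tensor \<Rightarrow> (nat \<Rightarrow> real mat) \<Rightarrow> real"
where
  "loss N J \<Omega> lam X G A =
     (\<Sum>\<alpha>\<in>\<Omega>. (X \<alpha> - (\<Sum>\<beta>\<in>index_tuples N J. G \<beta> * (\<Prod>k<N. A k $$ (\<alpha> k, \<beta> k))))\<^sup>2)
     + lam * (\<Sum>k<N. (frobenius_norm (A k))\<^sup>2)"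

definition replace_row :: "real mat \<Rightarrow> nat \<Rightarrow> real mat \<Rightarrow> real mat" where
  "replace_row A i v =
     mat (dim_row A) (dim_col A) (\<lambda>(r, j). if r = i then v $$ (0, j) else A $$ (r, j))"

definition obs_slice :: "(nat \<Rightarrow> nat) set \<Rightarrow> nat \<Rightarrow> nat \<Rightarrow> (nat \<Rightarrow> nat) set" where
  "obs_slice \<Omega> n i = {\<alpha> \<in> \<Omega>. \<alpha> n = i}"

definition delta_row ::
  "nat \<Rightarrow> (nat \<Rightarrow> nat) \<Rightarrow> tensor \<Rightarrow> (nat \<Rightarrow> real mat) \<Rightarrow> nat \<Rightarrow> (nat \<Rightarrow> nat) \<Rightarrow> real mat"
where
  "delta_row N J G A n \<alpha> =
     mat 1 (J n) (\<lambda>(_, j). \<Sum>\<beta>\<in>{\<beta> \<in> index_tuples N J. \<beta> n = j}.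
       G \<beta> * (\<Prod>k\<in>{..<N} - {n}. A k $$ (\<alpha> k, \<beta> k)))"

definition B_mat ::
  "nat \<Rightarrow> (nat \<Rightarrow> nat) \<Rightarrow> (nat \<Rightarrow> nat) set \<Rightarrow> tensor \<Rightarrow> (nat \<Rightarrow> real mat) \<Rightarrow> nat \<Rightarrow> nat \<Rightarrow> real mat"
where
  "B_mat N J \<Omega> G A n i =
     mat (J n) (J n) (\<lambda>(j, j'). \<Sum>\<alpha>\<in>obs_slice \<Omega> n i.
       delta_row N J G A n \<alpha> $$ (0, j) * delta_row N J G A n \<alpha> $$ (0, j'))"

definition c_row ::
  "nat \<Rightarrow> (nat \<Rightarrow> nat) \<Rightarrow> (nat \<Rightarrow> nat) set \<Rightarrow> tensor \<Rightarrow> tensor \<Rightarrow> (nat \<Rightarrow> real mat) \<Rightarrow> nat \<Rightarrow> nat \<Rightarrow> real mat"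
where
  "c_row N J \<Omega> X G A n i =
     mat 1 (J n) (\<lambda>(_, j). \<Sum>\<alpha>\<in>obs_slice \<Omega> n i. X \<alpha> * delta_row N J G A n \<alpha> $$ (0, j))"

end

theory Submission
  imports Defs "Jordan_Normal_Form.Determinant"
begin

text \<open>
  As a function of the selected row, the loss is a constant plus the ridge regression objective
  with design rows \<open>\<delta>\<^sub>\<alpha>\<close> and targets \<open>X \<alpha>\<close>, \<open>\<alpha>\<close> in the slice.  If \<open>w\<close> solves the normal
  equations, the cross terms cancel and the objective at \<open>x\<close> exceeds that at \<open>w\<close> by
  \<open>\<Sum>\<^sub>\<alpha> (\<delta>\<^sub>\<alpha> \<bullet> (x - w))\<^sup>2 + \<lambda> \<parallel>x - w\<parallel>\<^sup>2\<close>, which is positive unless \<open>x = w\<close>.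
\<close>

section \<open>Ridge regression: objective, normal equations, uniqueness of the minimizer\<close>

definition ridge ::
  "'a set \<Rightarrow> nat \<Rightarrow> real \<Rightarrow> ('a \<Rightarrow> real) \<Rightarrow> ('a \<Rightarrow> nat \<Rightarrow> real) \<Rightarrow> (nat \<Rightarrow> real) \<Rightarrow> real"
where
  "ridge S m lam y d x = (\<Sum>a\<in>S. (y a - (\<Sum>j<m. d a j * x j))\<^sup>2) + lam * (\<Sum>j<m. (x j)\<^sup>2)"

text \<open>Half the gradient of \<open>ridge\<close> set to zero. The unknown \<open>w\<close>
  multiplies the Gram matrix from the left, to match the row-vector form of the update rule.\<close>

definition normal_equations ::
  "'a set \<Rightarrow> nat \<Rightarrow> real \<Rightarrow> ('a \<Rightarrow> real) \<Rightarrow> ('a \<Rightarrow> nat \<Rightarrow> real) \<Rightarrow> (nat \<Rightarrow> real) \<Rightarrow> bool"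
where
  "normal_equations S m lam y d w \<longleftrightarrow>
     (\<forall>k<m. (\<Sum>j<m. w j * (\<Sum>a\<in>S. d a j * d a k)) + lam * w k = (\<Sum>a\<in>S. y a * d a k))"

text \<open>Completing the square. The excess is itself a \<open>ridge\<close> value, with zero
  targets and argument \<open>x - w\<close>, so sign and definiteness facts about
  \<open>ridge\<close> apply to it directly.\<close>

lemma ridge_excess:
  assumes "normal_equations S m lam y d w"
  shows "ridge S m lam y d x = ridge S m lam y d w + ridge S m lam (\<lambda>_. 0) d (\<lambda>j. x j - w j)"
proof -
  define h where "h j = x j - w j" for j
  define r where "r a = y a - (\<Sum>j<m. d a j * w j)" for a
  define g where "g a = (\<Sum>j<m. d a j * h j)" for a
  have res: "y a - (\<Sum>j<m. d a j * x j) = r a - g a" for a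
    by (simp add: r_def g_def h_def algebra_simps sum_subtractf)
  \<comment> \<open>The normal equations in residual form: the residual \<open>r\<close> at
    \<open>w\<close> has correlation \<open>lam * w k\<close> with the k-th column of the
    design.\<close>
  have normal: "(\<Sum>a\<in>S. r a * d a k) = lam * w k" if "k < m" for k
  proof -
    have "(\<Sum>a\<in>S. r a * d a k) = (\<Sum>a\<in>S. y a * d a k) - (\<Sum>a\<in>S. \<Sum>j<m. d a j * w j * d a k)"
      by (simp add: r_def left_diff_distrib sum_subtractf sum_distrib_right)
    also have "(\<Sum>a\<in>S. \<Sum>j<m. d a j * w j * d a k) = (\<Sum>j<m. w j * (\<Sum>a\<in>S. d a j * d a k))"
      by (subst sum.swap) (simp add: sum_distrib_left mult_ac)
    finally show ?thesis
      using assms that unfolding normal_equations_def by force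
  qed
  \<comment> \<open>Weighting the residual equations with \<open>h\<close> evaluates the cross term
    of the fit; it cancels against the cross term \<open>2 * lam * (\<Sum>j<m. w j * h j)\<close> of
    the penalty.\<close>
  have "(\<Sum>a\<in>S. r a * g a) = (\<Sum>j<m. h j * (\<Sum>a\<in>S. r a * d a j))"
    unfolding g_def sum_distrib_left by (subst sum.swap) (simp add: mult_ac)
  also have "\<dots> = lam * (\<Sum>j<m. w j * h j)"
    by (simp add: normal sum_distrib_left mult_ac)
  finally have cross: "(\<Sum>a\<in>S. r a * g a) = lam * (\<Sum>j<m. w j * h j)" .
  have "(\<Sum>a\<in>S. (r a - g a)\<^sup>2) = (\<Sum>a\<in>S. (r a)\<^sup>2) - 2 * (\<Sum>a\<in>S. r a * g a) + (\<Sum>a\<in>S. (g a)\<^sup>2)"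
    by (simp add: power2_diff sum.distrib sum_subtractf sum_distrib_left mult_ac)
  moreover have "(\<Sum>j<m. (x j)\<^sup>2) =
      (\<Sum>j<m. (w j)\<^sup>2) + 2 * (\<Sum>j<m. w j * h j) + (\<Sum>j<m. (h j)\<^sup>2)"
  proof -
    have "(\<Sum>j<m. (x j)\<^sup>2) = (\<Sum>j<m. (w j + h j)\<^sup>2)"
      by (simp add: h_def)
    then show ?thesis
      by (simp add: power2_sum sum.distrib sum_distrib_left mult_ac)
  qed
  moreover have "ridge S m lam y d x = (\<Sum>a\<in>S. (r a - g a)\<^sup>2) + lam * (\<Sum>j<m. (x j)\<^sup>2)"
    unfolding ridge_def res ..
  moreover have "ridge S m lam y d w = (\<Sum>a\<in>S. (r a)\<^sup>2) + lam * (\<Sum>j<m. (w j)\<^sup>2)"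
    unfolding ridge_def r_def ..
  moreover have "ridge S m lam (\<lambda>_. 0) d h = (\<Sum>a\<in>S. (g a)\<^sup>2) + lam * (\<Sum>j<m. (h j)\<^sup>2)"
    by (simp add: ridge_def g_def)
  ultimately have "ridge S m lam y d x = ridge S m lam y d w + ridge S m lam (\<lambda>_. 0) d h"
    using cross by (simp add: algebra_simps)
  then show ?thesis
    unfolding h_def .
qed

lemma ridge_nonneg: "lam \<ge> 0 \<Longrightarrow> ridge S m lam y d x \<ge> 0"
  unfolding ridge_def by (intro add_nonneg_nonneg sum_nonneg mult_nonneg_nonneg) auto

text \<open>The fit term is nonnegative, so a value at most 0 leaves no room for the penalty; as
  \<open>lam\<close> is strictly positive, every coordinate vanishes.\<close>

lemma ridge_le_0_imp_zero:
  assumes "lam > 0" "ridge S m lam y d x \<le> 0" "j < m"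
  shows "x j = 0"
proof -
  have "0 \<le> (\<Sum>a\<in>S. (y a - (\<Sum>j<m. d a j * x j))\<^sup>2)"
    by (intro sum_nonneg) auto
  then have "lam * (\<Sum>j<m. (x j)\<^sup>2) \<le> 0"
    using assms(2) unfolding ridge_def by linarith
  then have "(\<Sum>j<m. (x j)\<^sup>2) \<le> 0"
    using \<open>lam > 0\<close> by (simp add: mult_le_0_iff)
  then have "(\<Sum>j<m. (x j)\<^sup>2) = 0"
    by (intro antisym sum_nonneg) auto
  then show ?thesis
    using \<open>j < m\<close> by (simp add: sum_nonneg_eq_0_iff)
qed

text \<open>With zero targets the objective is 0 at the origin. Since \<open>x\<close> solves the
  normal equations, this 0 is the value at \<open>x\<close> plus a nonnegative excess, so the value
  at \<open>x\<close> is at most 0.\<close>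

lemma normal_equations_zero_imp_zero:
  assumes "lam > 0" "normal_equations S m lam (\<lambda>_. 0) d x" "j < m"
  shows "x j = 0"
proof -
  have "ridge S m lam (\<lambda>_. 0) d (\<lambda>_. 0) =
      ridge S m lam (\<lambda>_. 0) d x + ridge S m lam (\<lambda>_. 0) d (\<lambda>j. 0 - x j)"
    by (rule ridge_excess[OF assms(2)])
  moreover have "ridge S m lam (\<lambda>_. 0) d (\<lambda>j. 0 - x j) \<ge> 0"
    using \<open>lam > 0\<close> by (intro ridge_nonneg) simp
  moreover have "ridge S m lam (\<lambda>_. 0) d (\<lambda>_. 0) = 0"
    by (simp add: ridge_def)
  ultimately have "ridge S m lam (\<lambda>_. 0) d x \<le> 0"
    by linarith
  then show ?thesis
    using assms by (intro ridge_le_0_imp_zero)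
qed

section \<open>The regularized Gram matrix and its inverse\<close>

definition normal_matrix :: "'a set \<Rightarrow> nat \<Rightarrow> real \<Rightarrow> ('a \<Rightarrow> nat \<Rightarrow> real) \<Rightarrow> real mat" where
  "normal_matrix S m lam d =
     mat m m (\<lambda>(j, k). \<Sum>a\<in>S. d a j * d a k) + lam \<cdot>\<^sub>m 1\<^sub>m m"

lemma normal_matrix_carrier [simp]: "normal_matrix S m lam d \<in> carrier_mat m m"
  by (simp add: normal_matrix_def)

text \<open>Identifies the left side of \<open>normal_equations\<close> with a row vector times
  \<open>normal_matrix\<close>; the identity matrix contributes only the term with
  \<open>j = k\<close>.\<close>

lemma normal_matrix_row_mult:
  assumes "k < m"
  shows "(\<Sum>j<m. w j * normal_matrix S m lam d $$ (j, k)) =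
    (\<Sum>j<m. w j * (\<Sum>a\<in>S. d a j * d a k)) + lam * w k"
proof -
  have "(\<Sum>j<m. w j * normal_matrix S m lam d $$ (j, k)) =
      (\<Sum>j<m. w j * (\<Sum>a\<in>S. d a j * d a k) + (if j = k then lam * w k else 0))"
    using assms by (intro sum.cong) (auto simp: normal_matrix_def algebra_simps)
  also have "\<dots> = (\<Sum>j<m. w j * (\<Sum>a\<in>S. d a j * d a k)) + lam * w k"
    using assms by (simp add: sum.distrib)
  finally show ?thesis .
qed

lemma normal_matrix_symmetric:
  "j < m \<Longrightarrow> k < m \<Longrightarrow> normal_matrix S m lam d $$ (j, k) = normal_matrix S m lam d $$ (k, j)"
  by (auto simp: normal_matrix_def mult.commute)

text \<open>A kernel vector would solve the normal equations with zero targets, and these have only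
  the zero solution.\<close>

lemma det_normal_matrix:
  assumes "lam > 0"
  shows "det (normal_matrix S m lam d) \<noteq> 0"
proof
  let ?M = "normal_matrix S m lam d"
  assume "det ?M = 0"
  then obtain v where v: "v \<in> carrier_vec m" "v \<noteq> 0\<^sub>v m" "?M *\<^sub>v v = 0\<^sub>v m"
    using det_0_iff_vec_prod_zero[OF normal_matrix_carrier, of S m lam d] by auto
  have "(\<Sum>j<m. v $ j * ?M $$ (j, k)) = 0" if "k < m" for k
  proof -
    \<comment> \<open>The determinant criterion supplies a column vector, whereas the normal
      equations have the vector on the left; symmetry of the matrix bridges the two.\<close>
    have "(\<Sum>j<m. v $ j * ?M $$ (j, k)) = (\<Sum>j<m. ?M $$ (k, j) * v $ j)"
      using that by (intro sum.cong) (auto simp: normal_matrix_symmetric mult.commute)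
    also have "\<dots> = (?M *\<^sub>v v) $ k"
      using that v(1) carrier_matD[OF normal_matrix_carrier, of S m lam d]
      by (simp add: scalar_prod_def atLeast0LessThan)
    finally show ?thesis
      using v(3) that by simp
  qed
  then have "normal_equations S m lam (\<lambda>_. 0) d (\<lambda>j. v $ j)"
    by (simp add: normal_equations_def normal_matrix_row_mult)
  then have "v $ j = 0" if "j < m" for j
    using normal_equations_zero_imp_zero[OF assms] that by blast
  then have "v = 0\<^sub>v m"
    using v(1) by (intro eq_vecI) auto
  with v(2) show False by simp
qed

text \<open>\<open>mat_inverse\<close> returns an option. A nonzero determinant makes
  \<open>M\<close> a unit of the matrix ring, which rules out \<open>None\<close>, so
  \<open>the\<close> yields a genuine inverse.\<close>

lemma invertible_mat_if_det:
  fixes M :: "'a::field mat"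
  assumes M: "M \<in> carrier_mat m m" and "det M \<noteq> 0"
  shows "invertible_mat M"
    and "the (mat_inverse M) \<in> carrier_mat m m"
    and "the (mat_inverse M) * M = 1\<^sub>m m"
proof -
  have "M \<in> Units (ring_mat TYPE('a) m ())"
    by (rule det_non_zero_imp_unit[OF assms])
  then obtain B where B: "mat_inverse M = Some B"
    using mat_inverse(1)[OF M, where b = "()"] by (cases "mat_inverse M") auto
  have inv: "M * B = 1\<^sub>m m" "B * M = 1\<^sub>m m" "B \<in> carrier_mat m m"
    using mat_inverse(2)[OF M B] by auto
  then show "invertible_mat M"
    using M unfolding invertible_mat_def inverts_mat_def by auto
  show "the (mat_inverse M) \<in> carrier_mat m m" "the (mat_inverse M) * M = 1\<^sub>m m"
    using inv by (simp_all add: B)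
qed

section \<open>Dependence of the loss on one row\<close>

lemma finite_index_tuples [simp]: "finite (index_tuples N J)"
  by (simp add: index_tuples_def finite_PiE)

lemma frobenius_norm_square:
  "(frobenius_norm A)\<^sup>2 = (\<Sum>r<dim_row A. \<Sum>j<dim_col A. (A $$ (r, j))\<^sup>2)"
  by (simp add: frobenius_norm_def sum_nonneg)

lemma frobenius_norm_replace_row:
  assumes "i < dim_row A"
  shows "(frobenius_norm (replace_row A i v))\<^sup>2 =
    (\<Sum>r\<in>{..<dim_row A} - {i}. \<Sum>j<dim_col A. (A $$ (r, j))\<^sup>2) + (\<Sum>j<dim_col A. (v $$ (0, j))\<^sup>2)"
proof -
  have "(frobenius_norm (replace_row A i v))\<^sup>2 =
      (\<Sum>r<dim_row A. \<Sum>j<dim_col A. (if r = i then v $$ (0, j) else A $$ (r, j))\<^sup>2)"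
    by (simp add: frobenius_norm_square replace_row_def)
  also have "\<dots> = (\<Sum>j<dim_col A. (v $$ (0, j))\<^sup>2) +
      (\<Sum>r\<in>{..<dim_row A} - {i}. \<Sum>j<dim_col A. (if r = i then v $$ (0, j) else A $$ (r, j))\<^sup>2)"
    using assms by (subst sum.remove[of _ i]) auto
  also have "(\<Sum>r\<in>{..<dim_row A} - {i}. \<Sum>j<dim_col A. (if r = i then v $$ (0, j) else A $$ (r, j))\<^sup>2) =
      (\<Sum>r\<in>{..<dim_row A} - {i}. \<Sum>j<dim_col A. (A $$ (r, j))\<^sup>2)"
    by (intro sum.cong) auto
  finally show ?thesis by simp
qed

text \<open>Each product over the modes has exactly one factor from mode \<open>n\<close>, and it
  lies in the replaced row. Hence the reconstruction is linear in \<open>v\<close>, with coefficient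
  row \<delta>.\<close>

lemma reconstruction_in_slice:
  assumes "n < N" "dim_row (A n) > i" "dim_col (A n) = J n" "\<alpha> n = i"
  shows "(\<Sum>\<beta>\<in>index_tuples N J. G \<beta> *
      (\<Prod>k<N. (A(n := replace_row (A n) i v)) k $$ (\<alpha> k, \<beta> k))) =
    (\<Sum>j<J n. delta_row N J G A n \<alpha> $$ (0, j) * v $$ (0, j))"
proof -
  let ?P = "\<lambda>\<beta>. \<Prod>k\<in>{..<N} - {n}. A k $$ (\<alpha> k, \<beta> k)"
  have coord: "\<beta> n < J n" if "\<beta> \<in> index_tuples N J" for \<beta>
    using that \<open>n < N\<close> by (auto simp: index_tuples_def PiE_iff)
  have "(\<Sum>\<beta>\<in>index_tuples N J. G \<beta> * (\<Prod>k<N. (A(n := replace_row (A n) i v)) k $$ (\<alpha> k, \<beta> k))) =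
      (\<Sum>\<beta>\<in>index_tuples N J. G \<beta> * ?P \<beta> * v $$ (0, \<beta> n))"
  proof (intro sum.cong refl)
    fix \<beta> assume "\<beta> \<in> index_tuples N J"
    have "(\<Prod>k<N. (A(n := replace_row (A n) i v)) k $$ (\<alpha> k, \<beta> k)) =
        replace_row (A n) i v $$ (\<alpha> n, \<beta> n) *
        (\<Prod>k\<in>{..<N} - {n}. (A(n := replace_row (A n) i v)) k $$ (\<alpha> k, \<beta> k))"
      using \<open>n < N\<close> by (subst prod.remove[of _ n]) auto
    also have "(\<Prod>k\<in>{..<N} - {n}. (A(n := replace_row (A n) i v)) k $$ (\<alpha> k, \<beta> k)) = ?P \<beta>"
      by (intro prod.cong) auto
    also have "replace_row (A n) i v $$ (\<alpha> n, \<beta> n) = v $$ (0, \<beta> n)"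
      using assms coord[OF \<open>\<beta> \<in> index_tuples N J\<close>] by (simp add: replace_row_def)
    finally show "G \<beta> * (\<Prod>k<N. (A(n := replace_row (A n) i v)) k $$ (\<alpha> k, \<beta> k)) =
        G \<beta> * ?P \<beta> * v $$ (0, \<beta> n)"
      by simp
  qed
  \<comment> \<open>The tuples are grouped by their coordinate in mode \<open>n\<close>; by
    \<open>coord\<close> the fibres over \<open>{..<J n}\<close> exhaust them.\<close>
  also have "\<dots> = (\<Sum>j<J n. \<Sum>\<beta>\<in>{\<beta> \<in> index_tuples N J. \<beta> n = j}. G \<beta> * ?P \<beta> * v $$ (0, \<beta> n))"
    using coord by (intro sum.group[symmetric]) auto
  also have "\<dots> = (\<Sum>j<J n. delta_row N J G A n \<alpha> $$ (0, j) * v $$ (0, j))"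
    by (intro sum.cong) (auto simp: delta_row_def sum_distrib_right)
  finally show ?thesis .
qed

text \<open>Mode \<open>n\<close> is read in a row other than \<open>i\<close>, which the
  replacement copies. The bounds keep the access within the dimensions, where the entries of
  \<open>mat\<close> are determined.\<close>

lemma reconstruction_off_slice:
  assumes "\<alpha> n < dim_row (A n)" "dim_col (A n) = J n" "n < N" "\<alpha> n \<noteq> i"
  shows "(\<Sum>\<beta>\<in>index_tuples N J. G \<beta> *
      (\<Prod>k<N. (A(n := replace_row (A n) i v)) k $$ (\<alpha> k, \<beta> k))) =
    (\<Sum>\<beta>\<in>index_tuples N J. G \<beta> * (\<Prod>k<N. A k $$ (\<alpha> k, \<beta> k)))"
proof (intro sum.cong refl arg_cong2[where f = "(*)"] prod.cong)
  fix \<beta> k assume "\<beta> \<in> index_tuples N J" "k \<in> {..<N}"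
  then have "\<beta> n < J n"
    using \<open>n < N\<close> by (auto simp: index_tuples_def PiE_iff)
  then show "(A(n := replace_row (A n) i v)) k $$ (\<alpha> k, \<beta> k) = A k $$ (\<alpha> k, \<beta> k)"
    using assms by (auto simp: replace_row_def)
qed

text \<open>One constant \<open>K\<close> serves all \<open>v\<close>. It collects the squared
  errors off the slice, the penalties of the other factor matrices and that of the other rows of
  \<open>A n\<close>.\<close>

lemma loss_replace_row:
  assumes \<Omega>: "\<Omega> \<subseteq> index_tuples N I" and A: "A n \<in> carrier_mat (I n) (J n)"
    and n: "n < N" and i: "i < I n"
  obtains K where "\<And>v. loss N J \<Omega> lam X G (A(n := replace_row (A n) i v)) =
    K + ridge (obs_slice \<Omega> n i) (J n) lam X (\<lambda>\<alpha> j. delta_row N J G A n \<alpha> $$ (0, j))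
      (\<lambda>j. v $$ (0, j))"
proof -
  let ?E = "\<lambda>A \<alpha>. (X \<alpha> - (\<Sum>\<beta>\<in>index_tuples N J. G \<beta> * (\<Prod>k<N. A k $$ (\<alpha> k, \<beta> k))))\<^sup>2"
  let ?S = "obs_slice \<Omega> n i"
  let ?K = "(\<Sum>\<alpha>\<in>\<Omega> - ?S. ?E A \<alpha>) + lam * ((\<Sum>k\<in>{..<N} - {n}. (frobenius_norm (A k))\<^sup>2) +
    (\<Sum>r\<in>{..<I n} - {i}. \<Sum>j<J n. (A n $$ (r, j))\<^sup>2))"
  have dims: "dim_row (A n) = I n" "dim_col (A n) = J n"
    using A by auto
  have fin: "finite \<Omega>"
    using \<Omega> finite_index_tuples finite_subset by blast
  have "loss N J \<Omega> lam X G (A(n := replace_row (A n) i v)) =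
      ?K + ridge ?S (J n) lam X (\<lambda>\<alpha> j. delta_row N J G A n \<alpha> $$ (0, j)) (\<lambda>j. v $$ (0, j))" for v
  proof -
    let ?A = "A(n := replace_row (A n) i v)"
    have "(\<Sum>\<alpha>\<in>\<Omega>. ?E ?A \<alpha>) = (\<Sum>\<alpha>\<in>\<Omega> - ?S. ?E ?A \<alpha>) + (\<Sum>\<alpha>\<in>?S. ?E ?A \<alpha>)"
      using fin by (intro sum.subset_diff) (auto simp: obs_slice_def)
    also have "(\<Sum>\<alpha>\<in>\<Omega> - ?S. ?E ?A \<alpha>) = (\<Sum>\<alpha>\<in>\<Omega> - ?S. ?E A \<alpha>)"
    proof (rule sum.cong[OF refl])
      fix \<alpha> assume "\<alpha> \<in> \<Omega> - ?S"
      then have "\<alpha> n < I n" "\<alpha> n \<noteq> i"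
        using \<Omega> n by (auto simp: index_tuples_def PiE_iff obs_slice_def)
      then show "?E ?A \<alpha> = ?E A \<alpha>"
        using n dims by (subst reconstruction_off_slice) auto
    qed
    also have "(\<Sum>\<alpha>\<in>?S. ?E ?A \<alpha>) =
        (\<Sum>\<alpha>\<in>?S. (X \<alpha> - (\<Sum>j<J n. delta_row N J G A n \<alpha> $$ (0, j) * v $$ (0, j)))\<^sup>2)"
    proof (rule sum.cong[OF refl])
      fix \<alpha> assume "\<alpha> \<in> ?S"
      then show "?E ?A \<alpha> = (X \<alpha> - (\<Sum>j<J n. delta_row N J G A n \<alpha> $$ (0, j) * v $$ (0, j)))\<^sup>2"
        using n dims i by (subst reconstruction_in_slice) (auto simp: obs_slice_def)
    qed
    finally have fit: "(\<Sum>\<alpha>\<in>\<Omega>. ?E ?A \<alpha>) = (\<Sum>\<alpha>\<in>\<Omega> - ?S. ?E A \<alpha>) +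
        (\<Sum>\<alpha>\<in>?S. (X \<alpha> - (\<Sum>j<J n. delta_row N J G A n \<alpha> $$ (0, j) * v $$ (0, j)))\<^sup>2)" .
    have "(\<Sum>k<N. (frobenius_norm (?A k))\<^sup>2) = (frobenius_norm (replace_row (A n) i v))\<^sup>2 +
        (\<Sum>k\<in>{..<N} - {n}. (frobenius_norm (?A k))\<^sup>2)"
      using n by (subst sum.remove[of _ n]) auto
    also have "(\<Sum>k\<in>{..<N} - {n}. (frobenius_norm (?A k))\<^sup>2) =
        (\<Sum>k\<in>{..<N} - {n}. (frobenius_norm (A k))\<^sup>2)"
      by (intro sum.cong) auto
    finally show ?thesis
      using i dims unfolding loss_def ridge_def fit
      by (simp add: frobenius_norm_replace_row algebra_simps)
  qed
  then show thesis
    using that by blast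
qed

theorem theorem1:
  fixes N n i :: nat
    and I J :: "nat \<Rightarrow> nat"
    and X G :: tensor
    and \<Omega> :: "(nat \<Rightarrow> nat) set"
    and A :: "nat \<Rightarrow> real mat"
    and lam :: real
  assumes "N \<ge> 1"
    and "\<Omega> \<subseteq> index_tuples N I"
    and "\<And>k. k < N \<Longrightarrow> A k \<in> carrier_mat (I k) (J k)"
    and "lam > 0"
    and "n < N"
    and "i < I n"
  shows "invertible_mat (B_mat N J \<Omega> G A n i + lam \<cdot>\<^sub>m 1\<^sub>m (J n)) \<and>
    {v. is_arg_min (\<lambda>v. loss N J \<Omega> lam X G (A(n := replace_row (A n) i v)))
          (\<lambda>v. v \<in> carrier_mat 1 (J n)) v}
    = {c_row N J \<Omega> X G A n i * the (mat_inverse (B_mat N J \<Omega> G A n i + lam \<cdot>\<^sub>m 1\<^sub>m (J n)))}"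
proof -
  define S where "S = obs_slice \<Omega> n i"
  define m where "m = J n"
  define d where "d \<alpha> j = delta_row N J G A n \<alpha> $$ (0, j)" for \<alpha> j
  define M where "M = normal_matrix S m lam d"
  define c where "c = c_row N J \<Omega> X G A n i"
  define w where "w = c * the (mat_inverse M)"
  let ?L = "\<lambda>v. loss N J \<Omega> lam X G (A(n := replace_row (A n) i v))"
  let ?R = "\<lambda>v. ridge S m lam X d (\<lambda>j. v $$ (0, j))"
  have M_eq: "B_mat N J \<Omega> G A n i + lam \<cdot>\<^sub>m 1\<^sub>m (J n) = M"
    by (simp add: M_def normal_matrix_def B_mat_def S_def m_def d_def)
  have M: "M \<in> carrier_mat m m"
    by (simp add: M_def)
  have "det M \<noteq> 0"
    unfolding M_def by (rule det_normal_matrix[OF \<open>lam > 0\<close>])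
  note inv = invertible_mat_if_det[OF M this]
  have c: "c \<in> carrier_mat 1 m"
    by (simp add: c_def c_row_def m_def)
  have w: "w \<in> carrier_mat 1 m"
    unfolding w_def using c inv(2) by (rule mult_carrier_mat)
  \<comment> \<open>Reassociating cancels the inverse; read entry by entry, the resulting equation
    is the system of normal equations for \<open>w\<close>.\<close>
  have "w * M = c"
    unfolding w_def using c inv(2,3) M by (simp add: assoc_mult_mat[of c 1 m _ m M m])
  then have "(\<Sum>j<m. w $$ (0, j) * M $$ (j, k)) = (\<Sum>a\<in>S. X a * d a k)" if "k < m" for k
  proof -
    have "(\<Sum>j<m. w $$ (0, j) * M $$ (j, k)) = (w * M) $$ (0, k)"
      using w M that by (simp add: scalar_prod_def atLeast0LessThan)
    also have "\<dots> = (\<Sum>a\<in>S. X a * d a k)"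
      using that by (simp add: \<open>w * M = c\<close>) (simp add: c_def c_row_def S_def m_def d_def)
    finally show ?thesis .
  qed
  then have normal: "normal_equations S m lam X d (\<lambda>j. w $$ (0, j))"
    by (simp add: normal_equations_def M_def normal_matrix_row_mult)
  obtain K where K: "\<And>v. ?L v = K + ?R v"
    using loss_replace_row[where \<Omega> = \<Omega> and A = A and lam = lam and X = X and G = G] assms
    unfolding S_def m_def d_def by metis
  \<comment> \<open>\<open>K\<close> cancels in the comparison of two rows, so the loss inherits the
    excess formula of \<open>ridge\<close>.\<close>
  have excess: "?L v = ?L w + ridge S m lam (\<lambda>_. 0) d (\<lambda>j. v $$ (0, j) - w $$ (0, j))" for v
    unfolding K ridge_excess[OF normal, of "\<lambda>j. v $$ (0, j)"] by simp
  have min: "?L w \<le> ?L v" for v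
    using excess[of v] ridge_nonneg[of lam S m "\<lambda>_. 0" d] \<open>lam > 0\<close> by (simp add: less_imp_le)
  \<comment> \<open>A row whose loss does not exceed that of \<open>w\<close> has excess at most 0,
    so definiteness forces all entries of the difference to vanish. This makes the set of minimizers
    a singleton.\<close>
  have unique: "v = w" if "v \<in> carrier_mat 1 m" "?L v \<le> ?L w" for v
  proof (rule eq_matI)
    have "v $$ (0, j) - w $$ (0, j) = 0" if "j < m" for j
      using \<open>lam > 0\<close> _ that
      by (rule ridge_le_0_imp_zero[of lam S m "\<lambda>_. 0" d]) (use excess[of v] \<open>?L v \<le> ?L w\<close> in linarith)
    then show "v $$ (r, j) = w $$ (r, j)" if "r < dim_row w" "j < dim_col w" for r j
      using w that by auto
  qed (use that w in auto)
  have "is_arg_min ?L (\<lambda>v. v \<in> carrier_mat 1 m) v \<longleftrightarrow> v = w" for v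
    using min unique w unfolding is_arg_min_linorder by blast
  then show ?thesis
    using inv(1) unfolding M_eq by (auto simp: w_def c_def m_def)
qed

end
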